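(* Tarski's relevance logic $\mathcal{L}_4$ contains Basic Logic. That is, for all formulas $A,B,C,D$, each of the following axioms belongs to $\mathcal{L}_4$: (A1) $A\to A$; (A2) $A\land B\to A$; (A3) $A\land B\to B$; (A4) $(A\to B)\land(A\to C)\to(A\to B\land C)$; (A5) $A\to A\lor B$; (A6) $B\to A\lor B$; (A7) $(A\to C)\land(B\to C)\to(A\lor B\to C)$; (A8) $A\land(B\lor C)\to(A\land B)\lor(A\land C)$; (A9) ${\sim}{\sim}A\to A$; and $\mathcal{L}_4$ is closed under the following rules: (R1) from $A\to B$ and $A$ infer $B$; (R2) from $A$ and $B$ infer $A\land B$; (R3) from $A\to B$ infer $(B\to C)\to(A\to C)$; (R4) from $A\to B$ infer $(C\to A)\to(C\to B)$; (R3$'$) from $A\to B$ and $C\to D$ infer $(B\to C)\to(A\to D)$; (R5) from $A\to{\sim}B$ infer $B\to{\sim}A$.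
   Context: Formulas are built from a countable set of propositional variables using the binary connectives $\lor,\land,\to$ and the unary connective $\sim$. Parentheses are omitted by the convention that connectives bind in the order $\sim$ (tightest), $\land$, $\lor$, $\to$. An assertion $A_{ij}$ is a formula $A$ together with an ordered pair of indices $i,j\in\{0,1,2,3\}$. A sequent $\Gamma\Rightarrow\Delta$ is an ordered pair of sets of assertions; commas denote union, and either side may be empty. A 4-proof is a finite sequence of sequents each of which is an Axiom or follows from one or two earlier sequents by a rule below ($\Gamma,\Gamma',\Delta,\Delta'$ are arbitrary sets of assertions, $i,j,k\in\{0,1,2,3\}$): - Axiom: $\Gamma\Rightarrow\Delta$ whenever $\Gamma\cap\Delta\neq\emptyset$. - Cut: from $\Gamma\Rightarrow\Delta,A_{ij}$ and $A_{ij},\Gamma'\Rightarrow\Delta'$ infer $\Gamma,\Gamma'\Rightarrow\Delta,\Delta'$. - Weakening: from $\Gamma\Rightarrow\Delta$ infer $\Gamma,\Gamma'\Rightarrow\Delta,\Delta'$. - $\lor|$: from $\Gamma,A_{ij}\Rightarrow\Delta$ and $\Gamma',B_{ij}\Rightarrow\Delta'$ infer $\Gamma,\Gamma',(A\lor B)_{ij}\Rightarrow\Delta,\Delta'$. - $|\lor$: from $\Gamma\Rightarrow\Delta,A_{ij},B_{ij}$ infer $\Gamma\Rightarrow\Delta,(A\lor B)_{ij}$. - $\land|$: from $\Gamma,A_{ij},B_{ij}\Rightarrow\Delta$ infer $\Gamma,(A\land B)_{ij}\Rightarrow\Delta$. - $|\land$: from $\Gamma\Rightarrow\Delta,A_{ij}$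 and $\Gamma'\Rightarrow\Delta',B_{ij}$ infer $\Gamma,\Gamma'\Rightarrow\Delta,\Delta',(A\land B)_{ij}$. - ${\sim}|$: from $\Gamma\Rightarrow\Delta,A_{ij}$ infer $\Gamma,({\sim}A)_{ji}\Rightarrow\Delta$. - $|{\sim}$: from $\Gamma,A_{ij}\Rightarrow\Delta$ infer $\Gamma\Rightarrow\Delta,({\sim}A)_{ji}$. - ${\to}|$: from $\Gamma\Rightarrow\Delta,A_{ki}$ and $\Gamma',B_{kj}\Rightarrow\Delta'$ infer $\Gamma,\Gamma',(A\to B)_{ij}\Rightarrow\Delta,\Delta'$. - $|{\to}$: from $\Gamma,A_{ki}\Rightarrow\Delta,B_{kj}$ infer $\Gamma\Rightarrow\Delta,(A\to B)_{ij}$, provided $k\neq i,j$ and $k$ does not occur as a subscript in any assertion of $\Gamma\cup\Delta$. Tarski's relevance logic $\mathcal{L}_4$ is the set of formulas $A$ such that the sequent $\Rightarrow A_{00}$ appears in some 4-proof. *)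

theory Defs
  imports Main
begin

datatype formula =
    Var nat
  | Disj formula formula  (infix "\<^bold>\<or>" 60)
  | Conj formula formula  (infix "\<^bold>\<and>" 65)
  | Imp formula formula  (infix "\<^bold>\<rightarrow>" 55)
  | Neg formula  ("\<^bold>\<sim>_" [70] 70)

(* The index set {0,1,2,3}; the indices carry no arithmetic structure. *)
datatype index = I0 | I1 | I2 | I3

type_synonym assertion = "formula \<times> index \<times> index"

abbreviation assertion_at :: "formula \<Rightarrow> index \<Rightarrow> index \<Rightarrow> assertion"  ("_\<langle>_,_\<rangle>" [1000, 0, 0] 1000)
  where "A\<langle>i,j\<rangle> \<equiv> (A, i, j)"

(* The sets of assertions in a sequent may be infinite. *)
type_synonym sequent = "assertion set \<times> assertion set"

abbreviation sequent_of :: "assertion set \<Rightarrow> assertion set \<Rightarrow> sequent"  (infix "\<turnstile>" 50)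
  where "\<Gamma> \<turnstile> \<Delta> \<equiv> (\<Gamma>, \<Delta>)"

definition occurs_in :: "index \<Rightarrow> assertion set \<Rightarrow> bool"
  where "occurs_in k \<Gamma> \<longleftrightarrow> (\<exists>A i j. A\<langle>i,j\<rangle> \<in> \<Gamma> \<and> (k = i \<or> k = j))"

definition is_axiom :: "sequent \<Rightarrow> bool"
  where "is_axiom S \<longleftrightarrow> (\<exists>\<Gamma> \<Delta>. S = (\<Gamma> \<turnstile> \<Delta>) \<and> \<Gamma> \<inter> \<Delta> \<noteq> {})"

(* In the rules below, the side formulas are arbitrary sets, so they may
   already contain the displayed assertions. *)
inductive rule1 :: "sequent \<Rightarrow> sequent \<Rightarrow> bool"  where
  weakening: "rule1 (\<Gamma> \<turnstile> \<Delta>) (\<Gamma> \<union> \<Gamma>' \<turnstile> \<Delta> \<union> \<Delta>')"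
| disj_right: "rule1 (\<Gamma> \<turnstile> \<Delta> \<union> {A\<langle>i,j\<rangle>, B\<langle>i,j\<rangle>}) (\<Gamma> \<turnstile> \<Delta> \<union> {(A \<^bold>\<or> B)\<langle>i,j\<rangle>})"
| conj_left: "rule1 (\<Gamma> \<union> {A\<langle>i,j\<rangle>, B\<langle>i,j\<rangle>} \<turnstile> \<Delta>) (\<Gamma> \<union> {(A \<^bold>\<and> B)\<langle>i,j\<rangle>} \<turnstile> \<Delta>)"
| neg_left: "rule1 (\<Gamma> \<turnstile> \<Delta> \<union> {A\<langle>i,j\<rangle>}) (\<Gamma> \<union> {(\<^bold>\<sim>A)\<langle>j,i\<rangle>} \<turnstile> \<Delta>)"
| neg_right: "rule1 (\<Gamma> \<union> {A\<langle>i,j\<rangle>} \<turnstile> \<Delta>) (\<Gamma> \<turnstile> \<Delta> \<union> {(\<^bold>\<sim>A)\<langle>j,i\<rangle>})"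
| imp_right: "\<lbrakk>k \<noteq> i; k \<noteq> j; \<not> occurs_in k (\<Gamma> \<union> \<Delta>)\<rbrakk> \<Longrightarrow>
    rule1 (\<Gamma> \<union> {A\<langle>k,i\<rangle>} \<turnstile> \<Delta> \<union> {B\<langle>k,j\<rangle>}) (\<Gamma> \<turnstile> \<Delta> \<union> {(A \<^bold>\<rightarrow> B)\<langle>i,j\<rangle>})"

inductive rule2 :: "sequent \<Rightarrow> sequent \<Rightarrow> sequent \<Rightarrow> bool"  where
  cut: "rule2 (\<Gamma> \<turnstile> \<Delta> \<union> {A\<langle>i,j\<rangle>}) ({A\<langle>i,j\<rangle>} \<union> \<Gamma>' \<turnstile> \<Delta>')
    (\<Gamma> \<union> \<Gamma>' \<turnstile> \<Delta> \<union> \<Delta>')"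
| disj_left: "rule2 (\<Gamma> \<union> {A\<langle>i,j\<rangle>} \<turnstile> \<Delta>) (\<Gamma>' \<union> {B\<langle>i,j\<rangle>} \<turnstile> \<Delta>')
    (\<Gamma> \<union> \<Gamma>' \<union> {(A \<^bold>\<or> B)\<langle>i,j\<rangle>} \<turnstile> \<Delta> \<union> \<Delta>')"
| conj_right: "rule2 (\<Gamma> \<turnstile> \<Delta> \<union> {A\<langle>i,j\<rangle>}) (\<Gamma>' \<turnstile> \<Delta>' \<union> {B\<langle>i,j\<rangle>})
    (\<Gamma> \<union> \<Gamma>' \<turnstile> \<Delta> \<union> \<Delta>' \<union> {(A \<^bold>\<and> B)\<langle>i,j\<rangle>})"
| imp_left: "rule2 (\<Gamma> \<turnstile> \<Delta> \<union> {A\<langle>k,i\<rangle>}) (\<Gamma>' \<union> {B\<langle>k,j\<rangle>} \<turnstile> \<Delta>')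
    (\<Gamma> \<union> \<Gamma>' \<union> {(A \<^bold>\<rightarrow> B)\<langle>i,j\<rangle>} \<turnstile> \<Delta> \<union> \<Delta>')"

definition four_proof :: "sequent list \<Rightarrow> bool"
  where "four_proof p \<longleftrightarrow> (\<forall>n < length p.
    is_axiom (p ! n) \<or>
    (\<exists>m < n. rule1 (p ! m) (p ! n)) \<or>
    (\<exists>l < n. \<exists>m < n. rule2 (p ! l) (p ! m) (p ! n)))"

definition L4 :: "formula set"
  where "L4 = {A. \<exists>p. four_proof p \<and> ({} \<turnstile> {A\<langle>I0,I0\<rangle>}) \<in> set p}"

end

theory Submission
  imports Defs
begin

text \<open>
  The pair of indices in an assertion is read as a pair of points, \<open>A\<langle>i,j\<rangle>\<close> saying that the
  binary relation denoted by \<open>A\<close> holds between \<open>i\<close> and \<open>j\<close>; negation is then the complement of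
  the converse, and an implication \<open>A \<^bold>\<rightarrow> B\<close> is the residual that relates \<open>i\<close> to \<open>j\<close> when every
  \<open>k\<close> with \<open>A\<langle>k,i\<rangle>\<close> satisfies \<open>B\<langle>k,j\<rangle>\<close>. Under this reading a theorem \<open>A \<^bold>\<rightarrow> B\<close>, although it is
  asserted at the one pair \<open>I0\<close>, \<open>I0\<close> only, should express the inclusion of one relation in
  the other. The lemma \<open>Imp_in_L4_iff\<close> makes this precise: \<open>A \<^bold>\<rightarrow> B\<close> is a theorem if and only
  if \<open>A\<langle>i,j\<rangle> \<turnstile> B\<langle>i,j\<rangle>\<close> is provable for all \<open>i\<close> and \<open>j\<close>.

  From right to left this is the right rule for implication with the fresh index \<open>I1\<close>.
  From left to right, cutting with the theorem yields \<open>A\<langle>k,I0\<rangle> \<turnstile> B\<langle>k,I0\<rangle>\<close> for each \<open>k\<close>. No rule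
  distinguishes an index from another, so provability is preserved by injective relabellings
  of the indices (\<open>derivable_relabel\<close>), and \<open>(I0, I0)\<close> and \<open>(I1, I0)\<close> can be moved to every pair
  of equal or of distinct indices respectively.

  After this reduction each axiom and rule is a short derivation. Proving an inclusion
  whose right-hand side is itself an implication takes one further index, distinct from the
  given two (\<open>entails_Imp\<close>).
\<close>

section \<open>Derivability and linear proofs\<close>

inductive derivable :: "sequent \<Rightarrow> bool" where
  axiom: "is_axiom S \<Longrightarrow> derivable S"
| step1: "derivable S \<Longrightarrow> rule1 S T \<Longrightarrow> derivable T"
| step2: "derivable S \<Longrightarrow> derivable S' \<Longrightarrow> rule2 S S' T \<Longrightarrow> derivable T"

lemma four_proof_derivable:
  assumes "four_proof p" and "n < length p"
  shows "derivable (p ! n)"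
  using assms(2)
proof (induction n rule: less_induct)
  case (less n)
  then consider "is_axiom (p ! n)"
    | m where "m < n" "rule1 (p ! m) (p ! n)"
    | l m where "l < n" "m < n" "rule2 (p ! l) (p ! m) (p ! n)"
    using assms(1) unfolding four_proof_def by blast
  then show ?case
    by cases (use less in \<open>auto intro: derivable.intros dest: less_trans\<close>)
qed

definition justified :: "sequent list \<Rightarrow> sequent \<Rightarrow> bool" where
  "justified p S \<longleftrightarrow>
    is_axiom S \<or> (\<exists>T \<in> set p. rule1 T S) \<or> (\<exists>T \<in> set p. \<exists>U \<in> set p. rule2 T U S)"

lemma justified_mono: "justified p S \<Longrightarrow> set p \<subseteq> set q \<Longrightarrow> justified q S"
  unfolding justified_def by blast

lemma four_proof_iff_justified:
  "four_proof p \<longleftrightarrow> (\<forall>n < length p. justified (take n p) (p ! n))"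
proof -
  have "(\<exists>T \<in> set (take n p). P T) \<longleftrightarrow> (\<exists>m < n. P (p ! m))" if "n < length p" for n P
    using nth_image[of n p] that by (auto simp flip: nth_image)
  then show ?thesis
    by (simp add: four_proof_def justified_def)
qed

lemma four_proof_snoc: "four_proof (p @ [S]) \<longleftrightarrow> four_proof p \<and> justified p S"
  by (auto simp: four_proof_iff_justified less_Suc_eq nth_append)

lemma four_proof_append: "four_proof p \<Longrightarrow> four_proof q \<Longrightarrow> four_proof (p @ q)"
proof (induction q rule: rev_induct)
  case (snoc S q)
  then show ?case
    using four_proof_snoc[of "p @ q" S] justified_mono[of q S "p @ q"]
    by (simp add: four_proof_snoc)
qed simp

lemma derivable_four_proof:
  assumes "derivable S"
  shows "\<exists>p. four_proof p \<and> S \<in> set p"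
  using assms
proof induction
  case (axiom S)
  then have "four_proof ([] @ [S])"
    unfolding four_proof_snoc by (simp add: four_proof_def justified_def)
  then show ?case by (intro exI[of _ "[S]"]) simp
next
  case (step1 S T)
  then obtain p where "four_proof p" "S \<in> set p" by blast
  with step1 have "four_proof (p @ [T])"
    unfolding four_proof_snoc justified_def by blast
  then show ?case by (intro exI[of _ "p @ [T]"]) simp
next
  case (step2 S S' T)
  then obtain p q where "four_proof p" "S \<in> set p" "four_proof q" "S' \<in> set q" by blast
  then have "four_proof (p @ q)" "S \<in> set (p @ q)" "S' \<in> set (p @ q)"
    by (auto intro: four_proof_append)
  with step2 have "four_proof ((p @ q) @ [T])"
    unfolding four_proof_snoc justified_def by blast
  then show ?case by (intro exI[of _ "(p @ q) @ [T]"]) simp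
qed

lemma L4_iff_derivable: "A \<in> L4 \<longleftrightarrow> derivable ({} \<turnstile> {A\<langle>I0,I0\<rangle>})"
  unfolding L4_def mem_Collect_eq
  by (metis derivable_four_proof four_proof_derivable in_set_conv_nth)

section \<open>Rules with shared contexts\<close>

text \<open>
  A sequent consists of sets, so a principal formula may be kept as a side formula of the
  premises. The rules below do this: read from the conclusion upwards, they only add
  assertions to the two sides, and no reordering or splitting of contexts is ever needed.
\<close>

lemma derivable_axiom: "a \<in> \<Gamma> \<Longrightarrow> a \<in> \<Delta> \<Longrightarrow> derivable (\<Gamma> \<turnstile> \<Delta>)"
  by (rule derivable.axiom) (auto simp: is_axiom_def)

lemma derivable_mono:
  assumes "derivable (\<Gamma> \<turnstile> \<Delta>)" "\<Gamma> \<subseteq> \<Gamma>'" "\<Delta> \<subseteq> \<Delta>'"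
  shows "derivable (\<Gamma>' \<turnstile> \<Delta>')"
  using derivable.step1[OF assms(1) rule1.weakening[of \<Gamma> \<Delta> \<Gamma>' \<Delta>']] assms(2,3)
  by (simp add: Un_absorb1)

lemma derivable_cut:
  assumes "derivable (\<Gamma> \<turnstile> insert A\<langle>i,j\<rangle> \<Delta>)" "derivable (insert A\<langle>i,j\<rangle> \<Gamma> \<turnstile> \<Delta>)"
  shows "derivable (\<Gamma> \<turnstile> \<Delta>)"
  using derivable.step2[OF _ _ rule2.cut[of \<Gamma> \<Delta> A i j \<Gamma> \<Delta>]] assms by simp

lemma derivable_Disj_left:
  assumes "(A \<^bold>\<or> B)\<langle>i,j\<rangle> \<in> \<Gamma>"
    and "derivable (insert A\<langle>i,j\<rangle> \<Gamma> \<turnstile> \<Delta>)" "derivable (insert B\<langle>i,j\<rangle> \<Gamma> \<turnstile> \<Delta>)"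
  shows "derivable (\<Gamma> \<turnstile> \<Delta>)"
  using derivable.step2[OF _ _ rule2.disj_left[of \<Gamma> A i j \<Delta> \<Gamma> B \<Delta>]] assms
  by (simp add: insert_absorb)

lemma derivable_Disj_right:
  assumes "(A \<^bold>\<or> B)\<langle>i,j\<rangle> \<in> \<Delta>"
    and "derivable (\<Gamma> \<turnstile> insert A\<langle>i,j\<rangle> (insert B\<langle>i,j\<rangle> \<Delta>))"
  shows "derivable (\<Gamma> \<turnstile> \<Delta>)"
  using derivable.step1[OF _ rule1.disj_right[of \<Gamma> \<Delta> A i j B]] assms
  by (simp add: insert_absorb)

lemma derivable_Conj_left:
  assumes "(A \<^bold>\<and> B)\<langle>i,j\<rangle> \<in> \<Gamma>"
    and "derivable (insert A\<langle>i,j\<rangle> (insert B\<langle>i,j\<rangle> \<Gamma>) \<turnstile> \<Delta>)"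
  shows "derivable (\<Gamma> \<turnstile> \<Delta>)"
  using derivable.step1[OF _ rule1.conj_left[of \<Gamma> A i j B \<Delta>]] assms
  by (simp add: insert_absorb)

lemma derivable_Conj_right:
  assumes "(A \<^bold>\<and> B)\<langle>i,j\<rangle> \<in> \<Delta>"
    and "derivable (\<Gamma> \<turnstile> insert A\<langle>i,j\<rangle> \<Delta>)" "derivable (\<Gamma> \<turnstile> insert B\<langle>i,j\<rangle> \<Delta>)"
  shows "derivable (\<Gamma> \<turnstile> \<Delta>)"
  using derivable.step2[OF _ _ rule2.conj_right[of \<Gamma> \<Delta> A i j \<Gamma> \<Delta> B]] assms
  by (simp add: insert_absorb)

lemma derivable_Neg_left:
  assumes "(\<^bold>\<sim>A)\<langle>j,i\<rangle> \<in> \<Gamma>" "derivable (\<Gamma> \<turnstile> insert A\<langle>i,j\<rangle> \<Delta>)"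
  shows "derivable (\<Gamma> \<turnstile> \<Delta>)"
  using derivable.step1[OF _ rule1.neg_left[of \<Gamma> \<Delta> A i j]] assms
  by (simp add: insert_absorb)

lemma derivable_Neg_right:
  assumes "(\<^bold>\<sim>A)\<langle>j,i\<rangle> \<in> \<Delta>" "derivable (insert A\<langle>i,j\<rangle> \<Gamma> \<turnstile> \<Delta>)"
  shows "derivable (\<Gamma> \<turnstile> \<Delta>)"
  using derivable.step1[OF _ rule1.neg_right[of \<Gamma> A i j \<Delta>]] assms
  by (simp add: insert_absorb)

lemma derivable_Imp_left:
  assumes "(A \<^bold>\<rightarrow> B)\<langle>i,j\<rangle> \<in> \<Gamma>"
    and "derivable (\<Gamma> \<turnstile> insert A\<langle>k,i\<rangle> \<Delta>)" "derivable (insert B\<langle>k,j\<rangle> \<Gamma> \<turnstile> \<Delta>)"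
  shows "derivable (\<Gamma> \<turnstile> \<Delta>)"
  using derivable.step2[OF _ _ rule2.imp_left[of \<Gamma> \<Delta> A k i \<Gamma> B j \<Delta>]] assms
  by (simp add: insert_absorb)

lemma derivable_Imp_right:
  assumes "k \<noteq> i" "k \<noteq> j" "\<not> occurs_in k (\<Gamma> \<union> \<Delta>)"
    and "derivable (insert A\<langle>k,i\<rangle> \<Gamma> \<turnstile> insert B\<langle>k,j\<rangle> \<Delta>)"
  shows "derivable (\<Gamma> \<turnstile> insert (A \<^bold>\<rightarrow> B)\<langle>i,j\<rangle> \<Delta>)"
  using derivable.step1[OF _ rule1.imp_right[OF assms(1-3), of A B]] assms(4) by simp

section \<open>Relabelling of indices\<close>

definition relabel :: "(index \<Rightarrow> index) \<Rightarrow> assertion set \<Rightarrow> assertion set" where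
  "relabel f \<Gamma> = (\<lambda>(A, i, j). A\<langle>f i, f j\<rangle>) ` \<Gamma>"

lemma relabel_simps [simp]:
  "relabel f {} = {}"
  "relabel f (insert A\<langle>i,j\<rangle> \<Gamma>) = insert A\<langle>f i, f j\<rangle> (relabel f \<Gamma>)"
  "relabel f (\<Gamma> \<union> \<Delta>) = relabel f \<Gamma> \<union> relabel f \<Delta>"
  unfolding relabel_def by (simp_all add: image_Un)

lemma occurs_in_relabel: "inj f \<Longrightarrow> occurs_in (f k) (relabel f \<Gamma>) \<longleftrightarrow> occurs_in k \<Gamma>"
proof -
  assume f: "inj f"
  have "occurs_in k \<Gamma> \<longleftrightarrow> (\<exists>x \<in> \<Gamma>. k = fst (snd x) \<or> k = snd (snd x))" for k \<Gamma>
    by (force simp: occurs_in_def)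
  with f show ?thesis
    by (simp add: relabel_def inj_eq case_prod_beta)
qed

lemma rule1_relabel:
  assumes "rule1 S T" "inj f"
  shows "rule1 (map_prod (relabel f) (relabel f) S) (map_prod (relabel f) (relabel f) T)"
  using assms(1)
proof cases
  case (imp_right k i j \<Gamma> \<Delta> A B)
  have "rule1 (relabel f \<Gamma> \<union> {A\<langle>f k, f i\<rangle>} \<turnstile> relabel f \<Delta> \<union> {B\<langle>f k, f j\<rangle>})
    (relabel f \<Gamma> \<turnstile> relabel f \<Delta> \<union> {(A \<^bold>\<rightarrow> B)\<langle>f i, f j\<rangle>})"
    using imp_right assms(2) occurs_in_relabel[OF assms(2), of k "\<Gamma> \<union> \<Delta>"]
    by (intro rule1.imp_right) (simp_all add: inj_eq)
  with imp_right show ?thesis by simp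
qed (simp_all only: map_prod_simp relabel_simps rule1.intros)

lemma rule2_relabel:
  assumes "rule2 S S' T"
  shows "rule2 (map_prod (relabel f) (relabel f) S) (map_prod (relabel f) (relabel f) S')
    (map_prod (relabel f) (relabel f) T)"
  using assms by cases (simp_all only: map_prod_simp relabel_simps rule2.intros)

text \<open>
  Indices are mentioned by name in no rule, only compared for equality. Injectivity is what
  keeps the index introduced by an implication on the right fresh after relabelling.
\<close>

lemma derivable_relabel_sequent:
  assumes "derivable S" "inj f"
  shows "derivable (map_prod (relabel f) (relabel f) S)"
  using assms(1)
proof induction
  case (axiom S)
  then obtain \<Gamma> \<Delta> a where "S = (\<Gamma> \<turnstile> \<Delta>)" "a \<in> \<Gamma>" "a \<in> \<Delta>"
    unfolding is_axiom_def by blast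
  then show ?case
    by (auto simp: relabel_def intro!: derivable_axiom[of "case a of (A, i, j) \<Rightarrow> A\<langle>f i, f j\<rangle>"])
qed (blast intro: derivable.intros rule1_relabel[OF _ assms(2)] rule2_relabel)+

lemma derivable_relabel:
  "derivable (\<Gamma> \<turnstile> \<Delta>) \<Longrightarrow> inj f \<Longrightarrow> derivable (relabel f \<Gamma> \<turnstile> relabel f \<Delta>)"
  using derivable_relabel_sequent[of "\<Gamma> \<turnstile> \<Delta>" f] by simp

section \<open>Implications as entailments\<close>

definition entails :: "formula \<Rightarrow> formula \<Rightarrow> bool" where
  "entails A B \<longleftrightarrow> (\<forall>i j. derivable ({A\<langle>i,j\<rangle>} \<turnstile> {B\<langle>i,j\<rangle>}))"

text \<open>
  It suffices to treat one pair of distinct and one pair of equal indices, since the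
  symmetric group acts transitively on the pairs of either kind.
\<close>

lemma entailsI:
  assumes "derivable ({A\<langle>I1,I0\<rangle>} \<turnstile> {B\<langle>I1,I0\<rangle>})" "derivable ({A\<langle>I0,I0\<rangle>} \<turnstile> {B\<langle>I0,I0\<rangle>})"
  shows "entails A B"
  unfolding entails_def
proof (intro allI)
  fix i j :: index
  show "derivable ({A\<langle>i,j\<rangle>} \<turnstile> {B\<langle>i,j\<rangle>})"
  proof (cases "i = j")
    case True
    have "inj (id(I0 := j, j := I0))"
      by (auto simp: inj_def)
    with derivable_relabel[OF assms(2) this] True show ?thesis
      by (simp split: if_splits)
  next
    case False
    obtain f :: "index \<Rightarrow> index" where f: "inj f" "f I1 = i" "f I0 = j"
    proof
      let ?t = "id(I0 := j, j := I0)"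
      let ?u = "id(?t I1 := i, i := ?t I1)"
      show "inj (?u \<circ> ?t)"
        by (rule inj_compose) (auto simp: inj_def)
      show "(?u \<circ> ?t) I1 = i" by simp
      show "(?u \<circ> ?t) I0 = j" using False by auto
    qed
    with derivable_relabel[OF assms(1) f(1)] show ?thesis by simp
  qed
qed

text \<open>
  Read upwards, the right rule for implication descends from \<open>(I0, I0)\<close> to \<open>(I1, I0)\<close> because
  its index has to be fresh. The left rule has no such condition: its index may also be \<open>I0\<close>,
  so that it reaches a pair of equal indices as well as a pair of distinct ones.
\<close>

lemma Imp_in_L4_iff: "A \<^bold>\<rightarrow> B \<in> L4 \<longleftrightarrow> entails A B"
proof
  assume "A \<^bold>\<rightarrow> B \<in> L4"
  then have *: "derivable ({} \<turnstile> {(A \<^bold>\<rightarrow> B)\<langle>I0,I0\<rangle>})"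
    by (simp add: L4_iff_derivable)
  have "derivable ({A\<langle>k,I0\<rangle>} \<turnstile> {B\<langle>k,I0\<rangle>})" for k
  proof (rule derivable_cut)
    show "derivable ({A\<langle>k,I0\<rangle>} \<turnstile> {(A \<^bold>\<rightarrow> B)\<langle>I0,I0\<rangle>, B\<langle>k,I0\<rangle>})"
      by (rule derivable_mono[OF *]) auto
    show "derivable ({(A \<^bold>\<rightarrow> B)\<langle>I0,I0\<rangle>, A\<langle>k,I0\<rangle>} \<turnstile> {B\<langle>k,I0\<rangle>})"
      by (rule derivable_Imp_left[of A B I0 I0 _ k]) (auto intro: derivable_axiom)
  qed
  then show "entails A B" by (intro entailsI)
next
  assume "entails A B"
  then have "derivable ({A\<langle>I1,I0\<rangle>} \<turnstile> {B\<langle>I1,I0\<rangle>})"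
    by (simp add: entails_def)
  then show "A \<^bold>\<rightarrow> B \<in> L4"
    unfolding L4_iff_derivable
    by (intro derivable_Imp_right[of I1]) (auto simp: occurs_in_def)
qed

lemma entailsD: "entails A B \<Longrightarrow> A\<langle>i,j\<rangle> \<in> \<Gamma> \<Longrightarrow> B\<langle>i,j\<rangle> \<in> \<Delta> \<Longrightarrow> derivable (\<Gamma> \<turnstile> \<Delta>)"
  unfolding entails_def by (rule derivable_mono[of "{A\<langle>i,j\<rangle>}" "{B\<langle>i,j\<rangle>}"]) simp_all

lemma entails_Imp:
  assumes "\<And>i j k. derivable ({A\<langle>k,i\<rangle>, X\<langle>i,j\<rangle>} \<turnstile> {B\<langle>k,j\<rangle>})"
  shows "entails X (A \<^bold>\<rightarrow> B)"
  unfolding entails_def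
proof (intro allI)
  fix i j
  have "\<exists>k \<in> {I0, I1, I2}. k \<noteq> i \<and> k \<noteq> j"
    by (cases i; cases j) simp_all
  then obtain k where "k \<noteq> i" "k \<noteq> j" by blast
  then show "derivable ({X\<langle>i,j\<rangle>} \<turnstile> {(A \<^bold>\<rightarrow> B)\<langle>i,j\<rangle>})"
    using assms[of k i j] by (intro derivable_Imp_right[of k]) (auto simp: occurs_in_def)
qed

section \<open>Basic Logic\<close>

lemma entails_refl: "entails A A"
  by (auto simp: entails_def intro: derivable_axiom)

lemma entails_Conj1: "entails (A \<^bold>\<and> B) A"
  unfolding entails_def
  by (intro allI, rule derivable_Conj_left[of A B]) (auto intro: derivable_axiom)

lemma entails_Conj2: "entails (A \<^bold>\<and> B) B"
  unfolding entails_def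
  by (intro allI, rule derivable_Conj_left[of A B]) (auto intro: derivable_axiom)

lemma entails_Disj1: "entails A (A \<^bold>\<or> B)"
  unfolding entails_def
  by (intro allI, rule derivable_Disj_right[of A B]) (auto intro: derivable_axiom)

lemma entails_Disj2: "entails B (A \<^bold>\<or> B)"
  unfolding entails_def
  by (intro allI, rule derivable_Disj_right[of A B]) (auto intro: derivable_axiom)

lemma entails_Imp_Conj: "entails ((A \<^bold>\<rightarrow> B) \<^bold>\<and> (A \<^bold>\<rightarrow> C)) (A \<^bold>\<rightarrow> B \<^bold>\<and> C)"
proof (rule entails_Imp)
  fix i j k
  let ?X = "(A \<^bold>\<rightarrow> B) \<^bold>\<and> (A \<^bold>\<rightarrow> C)"
  let ?\<Gamma> = "{(A \<^bold>\<rightarrow> B)\<langle>i,j\<rangle>, (A \<^bold>\<rightarrow> C)\<langle>i,j\<rangle>, A\<langle>k,i\<rangle>, ?X\<langle>i,j\<rangle>}"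
  have "derivable (?\<Gamma> \<turnstile> {B\<langle>k,j\<rangle>, (B \<^bold>\<and> C)\<langle>k,j\<rangle>})"
    by (rule derivable_Imp_left[of A B i j _ k]) (auto intro: derivable_axiom)
  moreover have "derivable (?\<Gamma> \<turnstile> {C\<langle>k,j\<rangle>, (B \<^bold>\<and> C)\<langle>k,j\<rangle>})"
    by (rule derivable_Imp_left[of A C i j _ k]) (auto intro: derivable_axiom)
  ultimately have "derivable (?\<Gamma> \<turnstile> {(B \<^bold>\<and> C)\<langle>k,j\<rangle>})"
    by (rule derivable_Conj_right[rotated]) simp
  then show "derivable ({A\<langle>k,i\<rangle>, ?X\<langle>i,j\<rangle>} \<turnstile> {(B \<^bold>\<and> C)\<langle>k,j\<rangle>})"
    by (rule derivable_Conj_left[rotated]) simp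
qed

lemma entails_Disj_Imp: "entails ((A \<^bold>\<rightarrow> C) \<^bold>\<and> (B \<^bold>\<rightarrow> C)) (A \<^bold>\<or> B \<^bold>\<rightarrow> C)"
proof (rule entails_Imp)
  fix i j k
  let ?X = "(A \<^bold>\<rightarrow> C) \<^bold>\<and> (B \<^bold>\<rightarrow> C)"
  let ?\<Gamma> = "{(A \<^bold>\<rightarrow> C)\<langle>i,j\<rangle>, (B \<^bold>\<rightarrow> C)\<langle>i,j\<rangle>, (A \<^bold>\<or> B)\<langle>k,i\<rangle>, ?X\<langle>i,j\<rangle>}"
  have "derivable (insert A\<langle>k,i\<rangle> ?\<Gamma> \<turnstile> {C\<langle>k,j\<rangle>})"
    by (rule derivable_Imp_left[of A C i j _ k]) (auto intro: derivable_axiom)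
  moreover have "derivable (insert B\<langle>k,i\<rangle> ?\<Gamma> \<turnstile> {C\<langle>k,j\<rangle>})"
    by (rule derivable_Imp_left[of B C i j _ k]) (auto intro: derivable_axiom)
  ultimately have "derivable (?\<Gamma> \<turnstile> {C\<langle>k,j\<rangle>})"
    by (rule derivable_Disj_left[rotated]) simp
  then show "derivable ({(A \<^bold>\<or> B)\<langle>k,i\<rangle>, ?X\<langle>i,j\<rangle>} \<turnstile> {C\<langle>k,j\<rangle>})"
    by (rule derivable_Conj_left[rotated]) simp
qed

lemma entails_distrib: "entails (A \<^bold>\<and> (B \<^bold>\<or> C)) ((A \<^bold>\<and> B) \<^bold>\<or> (A \<^bold>\<and> C))"
  unfolding entails_def
proof (intro allI)
  fix i j
  let ?X = "A \<^bold>\<and> (B \<^bold>\<or> C)" and ?Y = "(A \<^bold>\<and> B) \<^bold>\<or> (A \<^bold>\<and> C)"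
  let ?\<Gamma> = "{A\<langle>i,j\<rangle>, (B \<^bold>\<or> C)\<langle>i,j\<rangle>, ?X\<langle>i,j\<rangle>}"
  let ?\<Delta> = "{(A \<^bold>\<and> B)\<langle>i,j\<rangle>, (A \<^bold>\<and> C)\<langle>i,j\<rangle>, ?Y\<langle>i,j\<rangle>}"
  have "derivable (insert B\<langle>i,j\<rangle> ?\<Gamma> \<turnstile> ?\<Delta>)"
    by (rule derivable_Conj_right[of A B i j]) (auto intro: derivable_axiom)
  moreover have "derivable (insert C\<langle>i,j\<rangle> ?\<Gamma> \<turnstile> ?\<Delta>)"
    by (rule derivable_Conj_right[of A C i j]) (auto intro: derivable_axiom)
  ultimately have "derivable (?\<Gamma> \<turnstile> ?\<Delta>)"
    by (rule derivable_Disj_left[rotated]) simp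
  then have "derivable (?\<Gamma> \<turnstile> {?Y\<langle>i,j\<rangle>})"
    by (rule derivable_Disj_right[rotated]) simp
  then show "derivable ({?X\<langle>i,j\<rangle>} \<turnstile> {?Y\<langle>i,j\<rangle>})"
    by (rule derivable_Conj_left[rotated]) simp
qed

lemma entails_Neg_Neg: "entails (\<^bold>\<sim>\<^bold>\<sim>A) A"
  unfolding entails_def
proof (intro allI)
  fix i j
  have "derivable ({(\<^bold>\<sim>\<^bold>\<sim>A)\<langle>i,j\<rangle>} \<turnstile> {(\<^bold>\<sim>A)\<langle>j,i\<rangle>, A\<langle>i,j\<rangle>})"
    by (rule derivable_Neg_right[of A j i]) (auto intro: derivable_axiom)
  then show "derivable ({(\<^bold>\<sim>\<^bold>\<sim>A)\<langle>i,j\<rangle>} \<turnstile> {A\<langle>i,j\<rangle>})"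
    by (rule derivable_Neg_left[rotated]) simp
qed

lemma L4_mp:
  assumes "A \<^bold>\<rightarrow> B \<in> L4" and "A \<in> L4"
  shows "B \<in> L4"
  unfolding L4_iff_derivable
proof (rule derivable_cut)
  show "derivable ({} \<turnstile> {A\<langle>I0,I0\<rangle>, B\<langle>I0,I0\<rangle>})"
    using assms(2) unfolding L4_iff_derivable by (rule derivable_mono) simp_all
  show "derivable ({A\<langle>I0,I0\<rangle>} \<turnstile> {B\<langle>I0,I0\<rangle>})"
    using assms(1) by (simp add: Imp_in_L4_iff entails_def)
qed

lemma L4_Conj:
  assumes "A \<in> L4" and "B \<in> L4"
  shows "A \<^bold>\<and> B \<in> L4"
  unfolding L4_iff_derivable
proof (rule derivable_Conj_right)
  show "derivable ({} \<turnstile> {A\<langle>I0,I0\<rangle>, (A \<^bold>\<and> B)\<langle>I0,I0\<rangle>})"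
    using assms(1) unfolding L4_iff_derivable by (rule derivable_mono) simp_all
  show "derivable ({} \<turnstile> {B\<langle>I0,I0\<rangle>, (A \<^bold>\<and> B)\<langle>I0,I0\<rangle>})"
    using assms(2) unfolding L4_iff_derivable by (rule derivable_mono) simp_all
qed simp

text \<open>
  Composition of inclusions: from \<open>A\<langle>k,i\<rangle>\<close> one gets \<open>B\<langle>k,i\<rangle>\<close>, hence \<open>C\<langle>k,j\<rangle>\<close> by the implication
  at \<open>(i, j)\<close>, and then \<open>D\<langle>k,j\<rangle>\<close>. Here the hypotheses are applied at pairs other than
  \<open>(I0, I0)\<close>.
\<close>

lemma entails_Imp_mono:
  assumes "entails A B" "entails C D"
  shows "entails (B \<^bold>\<rightarrow> C) (A \<^bold>\<rightarrow> D)"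
proof (rule entails_Imp)
  fix i j k
  show "derivable ({A\<langle>k,i\<rangle>, (B \<^bold>\<rightarrow> C)\<langle>i,j\<rangle>} \<turnstile> {D\<langle>k,j\<rangle>})"
    by (rule derivable_Imp_left[of B C i j _ k])
      (auto intro: entailsD[OF assms(1), of k i] entailsD[OF assms(2), of k j])
qed

text \<open>
  Negation exchanges the two indices, so contraposition at \<open>(i, j)\<close> uses the hypothesis at
  \<open>(j, i)\<close>.
\<close>

lemma entails_Neg_swap:
  assumes "entails A (\<^bold>\<sim>B)"
  shows "entails B (\<^bold>\<sim>A)"
  unfolding entails_def
proof (intro allI)
  fix i j
  have "derivable ({A\<langle>j,i\<rangle>, B\<langle>i,j\<rangle>} \<turnstile> {(\<^bold>\<sim>A)\<langle>i,j\<rangle>})"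
  proof (rule derivable_cut)
    show "derivable ({A\<langle>j,i\<rangle>, B\<langle>i,j\<rangle>} \<turnstile> {(\<^bold>\<sim>B)\<langle>j,i\<rangle>, (\<^bold>\<sim>A)\<langle>i,j\<rangle>})"
      by (rule entailsD[OF assms, of j i]) auto
    show "derivable ({(\<^bold>\<sim>B)\<langle>j,i\<rangle>, A\<langle>j,i\<rangle>, B\<langle>i,j\<rangle>} \<turnstile> {(\<^bold>\<sim>A)\<langle>i,j\<rangle>})"
      by (rule derivable_Neg_left[of B j i]) (auto intro: derivable_axiom)
  qed
  then show "derivable ({B\<langle>i,j\<rangle>} \<turnstile> {(\<^bold>\<sim>A)\<langle>i,j\<rangle>})"
    by (rule derivable_Neg_right[rotated]) simp
qed

theorem mainTheorem1:
  fixes A B C D :: formula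
  shows
   "\<comment> \<open>A1\<close> (A \<^bold>\<rightarrow> A \<in> L4) \<and>
    \<comment> \<open>A2\<close> (A \<^bold>\<and> B \<^bold>\<rightarrow> A \<in> L4) \<and>
    \<comment> \<open>A3\<close> (A \<^bold>\<and> B \<^bold>\<rightarrow> B \<in> L4) \<and>
    \<comment> \<open>A4\<close> ((A \<^bold>\<rightarrow> B) \<^bold>\<and> (A \<^bold>\<rightarrow> C) \<^bold>\<rightarrow> (A \<^bold>\<rightarrow> B \<^bold>\<and> C) \<in> L4) \<and>
    \<comment> \<open>A5\<close> (A \<^bold>\<rightarrow> A \<^bold>\<or> B \<in> L4) \<and>
    \<comment> \<open>A6\<close> (B \<^bold>\<rightarrow> A \<^bold>\<or> B \<in> L4) \<and>
    \<comment> \<open>A7\<close> ((A \<^bold>\<rightarrow> C) \<^bold>\<and> (B \<^bold>\<rightarrow> C) \<^bold>\<rightarrow> (A \<^bold>\<or> B \<^bold>\<rightarrow> C) \<in> L4) \<and>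
    \<comment> \<open>A8\<close> (A \<^bold>\<and> (B \<^bold>\<or> C) \<^bold>\<rightarrow> (A \<^bold>\<and> B) \<^bold>\<or> (A \<^bold>\<and> C) \<in> L4) \<and>
    \<comment> \<open>A9\<close> (\<^bold>\<sim>\<^bold>\<sim>A \<^bold>\<rightarrow> A \<in> L4) \<and>
    \<comment> \<open>R1\<close> (A \<^bold>\<rightarrow> B \<in> L4 \<and> A \<in> L4 \<longrightarrow> B \<in> L4) \<and>
    \<comment> \<open>R2\<close> (A \<in> L4 \<and> B \<in> L4 \<longrightarrow> A \<^bold>\<and> B \<in> L4) \<and>
    \<comment> \<open>R3\<close> (A \<^bold>\<rightarrow> B \<in> L4 \<longrightarrow> (B \<^bold>\<rightarrow> C) \<^bold>\<rightarrow> (A \<^bold>\<rightarrow> C) \<in> L4) \<and>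
    \<comment> \<open>R4\<close> (A \<^bold>\<rightarrow> B \<in> L4 \<longrightarrow> (C \<^bold>\<rightarrow> A) \<^bold>\<rightarrow> (C \<^bold>\<rightarrow> B) \<in> L4) \<and>
    \<comment> \<open>R3'\<close> (A \<^bold>\<rightarrow> B \<in> L4 \<and> C \<^bold>\<rightarrow> D \<in> L4 \<longrightarrow> (B \<^bold>\<rightarrow> C) \<^bold>\<rightarrow> (A \<^bold>\<rightarrow> D) \<in> L4) \<and>
    \<comment> \<open>R5\<close> (A \<^bold>\<rightarrow> \<^bold>\<sim>B \<in> L4 \<longrightarrow> B \<^bold>\<rightarrow> \<^bold>\<sim>A \<in> L4)"
  using L4_mp[of A B] L4_Conj[of A B]
  by (simp add: Imp_in_L4_iff entails_refl entails_Conj1 entails_Conj2 entails_Imp_Conj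
      entails_Disj1 entails_Disj2 entails_Disj_Imp entails_distrib entails_Neg_Neg
      entails_Imp_mono entails_Neg_swap)

end
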